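(* There is a universal constant $c>0$ with the following property. Let $K>0$, let $n\ge 2$ be an integer, and let $X=(X_1,X_2,\dots,X_n)$ be a vector of independent $K$-subgaussian real random variables. Then for every convex function $f:\mathbb{R}^n\to\mathbb{R}$ which is $1$-Lipschitz with respect to the Euclidean metric, and for every $t>0$, $$ \max\Big(\mathbb{P}\big\{f(X)-\mathrm{Med}\,f(X)\ge t\big\},\ \mathbb{P}\big\{f(X)-\mathrm{Med}\,f(X)\le -t\big\}\Big)\le \exp\left(-\frac{c\,t^2}{K^2\log\left(2+\frac{K^2 n}{t^2}\right)}\right). $$
   Context: For a real random variable $Y$, $\|Y\|_{\psi_2}:=\inf\{\lambda>0:\ \mathbb{E}\exp(Y^2/\lambda^2)\le 2\}$. $Y$ is called $K$-subgaussian if $\|Y\|_{\psi_2}\le K$. $\mathrm{Med}\,Y$ denotes a median of $Y$, i.e. a number $m$ with $\mathbb{P}\{Y\ge m\}\ge 1/2$ and $\mathbb{P}\{Y\le m\}\ge 1/2$. "Universal constant" means a constant not depending on any of the other parameters or objects. $\log$ is the natural logarithm. *)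

theory Defs
  imports "HOL-Probability.Probability"
begin

(* The infimum is taken in the extended half-line, so that the empty set gives
   infinity; the expectation is the nonnegative Lebesgue integral, which may be infinite. *)
definition psi2_norm :: "'a measure \<Rightarrow> ('a \<Rightarrow> real) \<Rightarrow> ennreal" where
  "psi2_norm M Y =
     Inf {ennreal l | l :: real. l > 0 \<and> (\<integral>\<^sup>+ \<omega>. ennreal (exp ((Y \<omega>)\<^sup>2 / l\<^sup>2)) \<partial>M) \<le> 2}"

definition subgaussian :: "'a measure \<Rightarrow> real \<Rightarrow> ('a \<Rightarrow> real) \<Rightarrow> bool" where
  "subgaussian M K Y \<longleftrightarrow> Y \<in> borel_measurable M \<and> psi2_norm M Y \<le> ennreal K"

definition is_median :: "'a measure \<Rightarrow> ('a \<Rightarrow> real) \<Rightarrow> real \<Rightarrow> bool" where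
  "is_median M Y m \<longleftrightarrow>
     measure M {\<omega> \<in> space M. Y \<omega> \<ge> m} \<ge> 1/2 \<and> measure M {\<omega> \<in> space M. Y \<omega> \<le> m} \<ge> 1/2"

(* The dimension n is quantified after the universal constant, so it cannot be a type
   index. A vector of R^n is a function on {..<n}, extended by undefined as in PiM;
   a function on R^n is only ever evaluated at such vectors. *)
definition Rn :: "nat \<Rightarrow> (nat \<Rightarrow> real) set" where
  "Rn n = {..<n} \<rightarrow>\<^sub>E (UNIV :: real set)"

definition convex_on_Rn :: "nat \<Rightarrow> ((nat \<Rightarrow> real) \<Rightarrow> real) \<Rightarrow> bool" where
  "convex_on_Rn n f \<longleftrightarrow>
     (\<forall>x\<in>Rn n. \<forall>y\<in>Rn n. \<forall>u\<ge>0. \<forall>v\<ge>0. u + v = 1 \<longrightarrow>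
        f (\<lambda>i\<in>{..<n}. u * x i + v * y i) \<le> u * f x + v * f y)"

definition lipschitz_on_Rn :: "nat \<Rightarrow> real \<Rightarrow> ((nat \<Rightarrow> real) \<Rightarrow> real) \<Rightarrow> bool" where
  "lipschitz_on_Rn n L f \<longleftrightarrow>
     (\<forall>x\<in>Rn n. \<forall>y\<in>Rn n. \<bar>f x - f y\<bar> \<le> L * L2_set (\<lambda>i. x i - y i) {..<n})"

definition random_vector :: "nat \<Rightarrow> (nat \<Rightarrow> 'a \<Rightarrow> real) \<Rightarrow> 'a \<Rightarrow> nat \<Rightarrow> real" where
  "random_vector n X \<omega> = (\<lambda>i\<in>{..<n}. X i \<omega>)"

(* The concentration inequality with constant c, for all random vectors on all probability
   spaces whose outcomes have type 'a; the components X_1, ..., X_n are X 0, ..., X (n - 1),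
   and m is an arbitrary median of f(X). *)
definition concentration_const :: "'a itself \<Rightarrow> real \<Rightarrow> bool" where
  "concentration_const (_ :: 'a itself) c \<longleftrightarrow>
     (\<forall>(K :: real) (n :: nat) (M :: 'a measure) (X :: nat \<Rightarrow> 'a \<Rightarrow> real)
        (f :: (nat \<Rightarrow> real) \<Rightarrow> real) (m :: real) (t :: real).
        K > 0 \<longrightarrow> n \<ge> 2 \<longrightarrow> prob_space M \<longrightarrow>
        prob_space.indep_vars M (\<lambda>_. borel) X {..<n} \<longrightarrow>
        (\<forall>i<n. subgaussian M K (X i)) \<longrightarrow>
        convex_on_Rn n f \<longrightarrow> lipschitz_on_Rn n 1 f \<longrightarrow>
        is_median M (\<lambda>\<omega>. f (random_vector n X \<omega>)) m \<longrightarrow> t > 0 \<longrightarrow>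
        max (measure M {\<omega> \<in> space M. f (random_vector n X \<omega>) - m \<ge> t})
            (measure M {\<omega> \<in> space M. f (random_vector n X \<omega>) - m \<le> - t})
          \<le> exp (- (c * t\<^sup>2 / (K\<^sup>2 * ln (2 + K\<^sup>2 * real n / t\<^sup>2)))))"

(* HOL cannot quantify over types inside a formula: in "EX c > 0. concentration_const
   TYPE('a) c" the constant could depend on the type 'a of outcomes. To say that one c serves
   all probability spaces, the existence of c is asserted for the fixed type nat => real, and
   it is asserted separately that every constant valid there is valid for an arbitrary 'a. *)

end

theory Submission
  imports Defs
begin

text \<open>The proof reduces subgaussian coordinates to bounded ones by truncation and treats bounded
  coordinates with the convex version of Talagrand's inequality.

  Split \<open>X = Y + Z\<close>, where \<open>Y\<close> keeps the coordinates of modulus at most \<open>b\<close> and \<open>Z\<close> the others.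
  A Lipschitz function moves by at most \<open>\<bar>Z\<bar>\<close>. Since \<open>Z\<close> rarely has a nonzero coordinate, the
  exponential moment of \<open>\<bar>Z\<bar>\<^sup>2 / (8 K\<^sup>2)\<close> is at most \<open>exp (2 n exp (- b\<^sup>2 / (8 K\<^sup>2)))\<close>
  (\<open>excess_norm_tail\<close>). If \<open>b\<^sup>2\<close> is of order \<open>K\<^sup>2 ln (2 + K\<^sup>2 n / t\<^sup>2)\<close>, the outer exponent is a small
  multiple of \<open>t\<^sup>2 / K\<^sup>2\<close>, and \<open>\<bar>Z\<bar> \<ge> t / 4\<close> has probability at most
  \<open>exp (- t\<^sup>2 / (256 K\<^sup>2))\<close>. On the other hand \<open>f Y\<close> deviates by \<open>t / 2\<close> with probability of order
  \<open>exp (- c t\<^sup>2 / b\<^sup>2)\<close>, which is the claimed rate.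

  The bounded case (\<open>convex_concentration_bounded\<close>) follows Maurey: with the infimal convolution
  \<open>Q g x = inf\<^sub>y (g y + c \<bar>x - y\<bar>\<^sup>2)\<close> and \<open>c\<close> of order \<open>1 / b\<^sup>2\<close>, every convex Lipschitz \<open>g \<ge> 0\<close> satisfies
  \<open>E exp (Q g) * E exp (- g) \<le> 1\<close> (\<open>inf_conv_exp_integral\<close>). Applied to a multiple of the positive
  part of \<open>f - a\<close>, this bounds \<open>P (f \<le> a) * P (f \<ge> a + s)\<close>, a quantity symmetric in the two sides,
  so that one inequality gives both tails.

  Both probabilities are at most \<open>1/2\<close> by the definition of a median. This absorbs the constant
  factors that the argument produces (\<open>absorb_constant\<close>) and makes it sufficient to consider
  large exponents, for which the median of \<open>f X\<close> is nearly one of \<open>f Y\<close>.\<close>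

section \<open>Convex and Lipschitz functions of finitely many coordinates\<close>

text \<open>Functions live on all of \<open>'i \<Rightarrow> real\<close>, not on an extensional product, so that a section at
  coordinate \<open>i\<close> is \<open>\<lambda>x. f (x(i := z))\<close> and has the same type. Being Lipschitz for the Euclidean
  seminorm of \<open>I\<close> forces \<open>f\<close> to depend on the coordinates in \<open>I\<close> only.\<close>
definition convex_fun :: "(('i \<Rightarrow> real) \<Rightarrow> real) \<Rightarrow> bool" where
  "convex_fun f \<longleftrightarrow> (\<forall>x y u v. 0 \<le> u \<longrightarrow> 0 \<le> v \<longrightarrow> u + v = 1 \<longrightarrow>
     f (\<lambda>i. u * x i + v * y i) \<le> u * f x + v * f y)"

definition lipschitz_in :: "'i set \<Rightarrow> real \<Rightarrow> (('i \<Rightarrow> real) \<Rightarrow> real) \<Rightarrow> bool" where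
  "lipschitz_in I L f \<longleftrightarrow> (\<forall>x y. \<bar>f x - f y\<bar> \<le> L * L2_set (\<lambda>i. x i - y i) I)"

lemma lipschitz_in_continuous:
  assumes "lipschitz_in I L f" shows "continuous_on UNIV f"
proof -
  have "(f \<longlongrightarrow> f x) (at x)" for x
  proof -
    have "((\<lambda>y. y i) \<longlongrightarrow> x i) (at x)" for i
      using continuous_on_product_coordinates[of i]
      by (auto simp: continuous_on_def)
    hence "((\<lambda>y. L * sqrt (\<Sum>i\<in>I. (y i - x i)\<^sup>2)) \<longlongrightarrow> L * sqrt (\<Sum>i\<in>I. (x i - x i)\<^sup>2)) (at x)"
      by (intro tendsto_intros)
    hence "((\<lambda>y. L * L2_set (\<lambda>i. y i - x i) I) \<longlongrightarrow> 0) (at x)"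
      by (simp add: L2_set_def)
    moreover have "\<forall>\<^sub>F y in at x. norm (f y - f x) \<le> L * L2_set (\<lambda>i. y i - x i) I"
      using assms by (auto simp: lipschitz_in_def)
    ultimately have "((\<lambda>y. f y - f x) \<longlongrightarrow> 0) (at x)"
      by (rule Lim_null_comparison[rotated])
    thus ?thesis by (simp add: LIM_zero_iff)
  qed
  thus ?thesis by (auto simp: continuous_on_def)
qed

text \<open>The index type is countable, so the product sigma-algebra over all indices is the Borel
  sigma-algebra of the product topology. The extensional product over \<open>J\<close> embeds into it, with the
  constant \<open>undefined\<close> at the other coordinates.\<close>
lemma lipschitz_in_measurable:
  fixes f :: "('i::countable \<Rightarrow> real) \<Rightarrow> real"
  assumes "lipschitz_in I L f" and sets: "\<And>i. sets (\<mu> i) = sets borel"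
  shows "f \<in> borel_measurable (PiM J \<mu>)"
proof -
  have "(\<lambda>x. x) \<in> measurable (PiM J (\<lambda>i. borel)) (PiM UNIV (\<lambda>i::'i. borel :: real measure))"
  proof (rule measurable_PiM_single')
    fix i :: 'i
    show "(\<lambda>x. x i) \<in> borel_measurable (PiM J (\<lambda>i. borel :: real measure))"
    proof (cases "i \<in> J")
      case False
      have "(\<lambda>x. undefined) \<in> borel_measurable (PiM J (\<lambda>i. borel :: real measure))" by simp
      moreover have "x i = undefined" if "x \<in> space (PiM J (\<lambda>i. borel :: real measure))" for x
        using that False by (auto simp: space_PiM PiE_def extensional_def)
      ultimately show ?thesis by (subst measurable_cong)
    qed auto
  qed (auto simp: space_PiM)
  hence id: "(\<lambda>x. x) \<in> measurable (PiM J \<mu>) (borel :: ('i \<Rightarrow> real) measure)"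
    by (subst measurable_cong_sets[OF sets_PiM_cong[OF refl sets] sets_PiM_equal_borel[symmetric]])
  show ?thesis
    using measurable_compose[OF id borel_measurable_continuous_onI[OF lipschitz_in_continuous[OF assms(1)]]] .
qed

section \<open>Infimal convolution with a quadratic cost\<close>
definition inf_conv :: "real \<Rightarrow> 'i set \<Rightarrow> (('i \<Rightarrow> real) \<Rightarrow> real) \<Rightarrow> ('i \<Rightarrow> real) \<Rightarrow> real" where
  "inf_conv c I f x = (INF y. f y + c * (\<Sum>i\<in>I. (x i - y i)\<^sup>2))"

lemma inf_conv_le:
  assumes "\<And>y. 0 \<le> f y" "0 \<le> c"
  shows "inf_conv c I f x \<le> f y + c * (\<Sum>i\<in>I. (x i - y i)\<^sup>2)"
  unfolding inf_conv_def
  by (rule cINF_lower) (auto intro!: bdd_belowI2[where m=0] add_nonneg_nonneg mult_nonneg_nonneg sum_nonneg assms)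

lemma inf_conv_greatest:
  assumes "\<And>y. B \<le> f y + c * (\<Sum>i\<in>I. (x i - y i)\<^sup>2)"
  shows "B \<le> inf_conv c I f x"
  unfolding inf_conv_def by (rule cINF_greatest) (auto intro: assms)

lemma inf_conv_approx:
  assumes "inf_conv c I f x < B"
  obtains y where "f y + c * (\<Sum>i\<in>I. (x i - y i)\<^sup>2) < B"
  using assms inf_conv_greatest[of B f c x I] by (meson not_le)

text \<open>Translating the competitor \<open>w\<close> by \<open>x - y\<close> keeps its distance, so the infima at \<open>x\<close> and \<open>y\<close>
  run over functions of \<open>w\<close> that differ by at most the change of \<open>f\<close> under the translation. In particular an
  infimal convolution is measurable, although it is an infimum of uncountably many functions.\<close>
lemma inf_conv_lipschitz:
  assumes L: "lipschitz_in I L f" and nn: "\<And>y. 0 \<le> f y" "0 \<le> c"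
  shows "lipschitz_in I L (inf_conv c I f)"
proof -
  have "inf_conv c I f x - L * L2_set (\<lambda>i. x i - y i) I \<le> inf_conv c I f y" for x y
  proof (rule inf_conv_greatest)
    fix w
    let ?w = "\<lambda>i. w i + x i - y i"
    have "inf_conv c I f x \<le> f ?w + c * (\<Sum>i\<in>I. (x i - ?w i)\<^sup>2)"
      by (rule inf_conv_le) (use nn in auto)
    also have "(\<Sum>i\<in>I. (x i - ?w i)\<^sup>2) = (\<Sum>i\<in>I. (y i - w i)\<^sup>2)" by simp
    finally have "inf_conv c I f x \<le> f ?w + c * (\<Sum>i\<in>I. (y i - w i)\<^sup>2)" .
    moreover have "\<bar>f ?w - f w\<bar> \<le> L * L2_set (\<lambda>i. ?w i - w i) I"
      using L unfolding lipschitz_in_def by blast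
    ultimately show "inf_conv c I f x - L * L2_set (\<lambda>i. x i - y i) I \<le> f w + c * (\<Sum>i\<in>I. (y i - w i)\<^sup>2)"
      by simp
  qed
  note * = this
  have sym: "L2_set (\<lambda>i. x i - y i) I = L2_set (\<lambda>i. y i - x i) I" for x y :: "'a \<Rightarrow> real"
    unfolding L2_set_def by (simp add: power2_commute)
  show ?thesis unfolding lipschitz_in_def
  proof (intro allI)
    fix x y
    show "\<bar>inf_conv c I f x - inf_conv c I f y\<bar> \<le> L * L2_set (\<lambda>i. x i - y i) I"
      using *[of x y] *[of y x] sym[of x y] by simp
  qed
qed

text \<open>This is where convexity enters. To approach \<open>(x, z)\<close>, mix a competitor of the section at \<open>w\<close>,
  with weight \<open>\<theta>\<close>, and one of the section at \<open>z\<close>. The price for leaving the section at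
  \<open>z\<close> is quadratic in \<open>\<theta>\<close>, whereas the gain from a better section will be linear.\<close>
lemma inf_conv_interpolate:
  assumes cv: "convex_fun f" and nn: "\<And>y. 0 \<le> f y" "0 \<le> c"
    and i: "i \<notin> I" "finite I" and th: "0 \<le> \<theta>" "\<theta> \<le> 1"
  shows "inf_conv c (insert i I) f (x(i := z)) \<le>
      \<theta> * inf_conv c I (\<lambda>y. f (y(i := w))) x + (1 - \<theta>) * inf_conv c I (\<lambda>y. f (y(i := z))) x
      + c * (\<theta>\<^sup>2 * (z - w)\<^sup>2)"
proof (rule field_le_epsilon)
  fix e :: real assume e: "0 < e"
  let ?W = "inf_conv c I (\<lambda>y. f (y(i := w))) x" and ?Z = "inf_conv c I (\<lambda>y. f (y(i := z))) x"
  let ?S = "\<lambda>y. \<Sum>j\<in>I. (x j - y j)\<^sup>2"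
  obtain y0 where y0: "f (y0(i := w)) + c * ?S y0 < ?W + e"
    by (rule inf_conv_approx[of c I "\<lambda>y. f (y(i := w))" x "?W + e"]) (use e in auto)
  obtain y1 where y1: "f (y1(i := z)) + c * ?S y1 < ?Z + e"
    by (rule inf_conv_approx[of c I "\<lambda>y. f (y(i := z))" x "?Z + e"]) (use e in auto)
  let ?y = "\<lambda>j. \<theta> * (y0(i := w)) j + (1 - \<theta>) * (y1(i := z)) j"
  have fy: "f ?y \<le> \<theta> * f (y0(i := w)) + (1 - \<theta>) * f (y1(i := z))"
    using cv[unfolded convex_fun_def, rule_format, where u = \<theta> and v = "1 - \<theta>" and x = "y0(i := w)" and y = "y1(i := z)"] th by simp
  have pt: "(x j - (\<theta> * y0 j + (1 - \<theta>) * y1 j))\<^sup>2 \<le> \<theta> * (x j - y0 j)\<^sup>2 + (1 - \<theta>) * (x j - y1 j)\<^sup>2" for j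
  proof -
    have "\<theta> * (x j - y0 j)\<^sup>2 + (1 - \<theta>) * (x j - y1 j)\<^sup>2 - (x j - (\<theta> * y0 j + (1 - \<theta>) * y1 j))\<^sup>2
       = \<theta> * (1 - \<theta>) * (y0 j - y1 j)\<^sup>2" by (simp add: power2_eq_square algebra_simps)
    moreover have "0 \<le> \<theta> * (1 - \<theta>) * (y0 j - y1 j)\<^sup>2" using th by simp
    ultimately show ?thesis by linarith
  qed
  have "(\<Sum>j\<in>insert i I. ((x(i := z)) j - ?y j)\<^sup>2)
     = (z - (\<theta> * w + (1 - \<theta>) * z))\<^sup>2 + (\<Sum>j\<in>I. (x j - (\<theta> * y0 j + (1 - \<theta>) * y1 j))\<^sup>2)"
    using i by (subst sum.insert) (auto intro!: sum.cong)
  also have "(z - (\<theta> * w + (1 - \<theta>) * z))\<^sup>2 = \<theta>\<^sup>2 * (z - w)\<^sup>2"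
    by (simp add: power2_eq_square algebra_simps)
  also have "(\<Sum>j\<in>I. (x j - (\<theta> * y0 j + (1 - \<theta>) * y1 j))\<^sup>2) \<le> \<theta> * ?S y0 + (1 - \<theta>) * ?S y1"
    unfolding sum_distrib_left sum.distrib[symmetric] by (intro sum_mono pt)
  finally have S: "c * (\<Sum>j\<in>insert i I. ((x(i := z)) j - ?y j)\<^sup>2) \<le>
      c * (\<theta>\<^sup>2 * (z - w)\<^sup>2 + (\<theta> * ?S y0 + (1 - \<theta>) * ?S y1))"
    using nn by (simp add: mult_left_mono)
  have "inf_conv c (insert i I) f (x(i := z)) \<le> f ?y + c * (\<Sum>j\<in>insert i I. ((x(i := z)) j - ?y j)\<^sup>2)"
    by (rule inf_conv_le) (use nn in auto)
  also have "\<dots> \<le> \<theta> * (f (y0(i := w)) + c * ?S y0) + (1 - \<theta>) * (f (y1(i := z)) + c * ?S y1) + c * (\<theta>\<^sup>2 * (z - w)\<^sup>2)"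
    using fy S by (simp add: algebra_simps)
  also have "\<dots> \<le> \<theta> * (?W + e) + (1 - \<theta>) * (?Z + e) + c * (\<theta>\<^sup>2 * (z - w)\<^sup>2)"
    using mult_left_mono[OF less_imp_le[OF y0] th(1)] mult_left_mono[OF less_imp_le[OF y1], of "1 - \<theta>"] th
    by linarith
  also have "\<dots> = \<theta> * ?W + (1 - \<theta>) * ?Z + c * (\<theta>\<^sup>2 * (z - w)\<^sup>2) + e" by (simp add: algebra_simps)
  finally show "inf_conv c (insert i I) f (x(i := z)) \<le> \<theta> * ?W + (1 - \<theta>) * ?Z + c * (\<theta>\<^sup>2 * (z - w)\<^sup>2) + e" .
qed

text \<open>The one-dimensional optimisation behind Talagrand's inequality, with \<open>l\<close> the logarithm of the
  ratio of two section integrals. The exponent is \<open>l - 7 l\<^sup>2 / 4\<close> for \<open>\<theta> = 2 l\<close>, and the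
  second order expansions of both exponentials then leave a margin of order \<open>l\<^sup>2\<close>; once \<open>2 l\<close>
  exceeds \<open>1\<close>, the weight \<open>\<theta> = 1\<close> suffices.\<close>
lemma exists_interpolation_weight:
  fixes l :: real assumes "0 \<le> l"
  obtains \<theta> where "0 \<le> \<theta>" "\<theta> \<le> 1" "exp ((1 - \<theta>) * l + \<theta>\<^sup>2 / 16) \<le> 2 - exp (- l)"
proof (cases "l \<le> 1/2")
  case True
  define u where "u = l - 7/4 * l\<^sup>2"
  have 1: "l\<^sup>2 \<le> l / 2" using True assms mult_right_mono[of l "1/2" l] by (simp add: power2_eq_square)
  have "0 \<le> l\<^sup>2" by simp
  hence u: "0 \<le> u" "u \<le> l" "u \<le> 1" using 1 True assms unfolding u_def by linarith+
  have "exp u \<le> 1 + u + u\<^sup>2" using u by (intro exp_bound) auto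
  also have "u\<^sup>2 \<le> l\<^sup>2" using u by (intro power_mono) auto
  finally have A: "exp u \<le> 1 + l - 3/4 * l\<^sup>2" unfolding u_def by simp
  have B: "exp (- l) \<le> 1 - l + l\<^sup>2 / 2"
  proof -
    have "exp (- l) \<le> inverse (1 + l + l\<^sup>2 / 2)"
      unfolding exp_minus
      by (rule le_imp_inverse_le[OF exp_lower_Taylor_quadratic]) (use assms in \<open>auto intro: add_pos_nonneg\<close>)
    also have "\<dots> \<le> 1 - l + l\<^sup>2 / 2"
    proof -
      have "(1 - l + l\<^sup>2 / 2) * (1 + l + l\<^sup>2 / 2) = 1 + (l\<^sup>2)\<^sup>2 / 4"
        by (simp add: power2_eq_square field_simps)
      moreover have "0 < 1 + l + l\<^sup>2 / 2" using assms by (auto intro: add_pos_nonneg)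
      ultimately show ?thesis by (simp add: inverse_eq_divide pos_divide_le_eq)
    qed
    finally show ?thesis .
  qed
  have "0 \<le> l\<^sup>2" by simp
  hence "exp u \<le> 2 - exp (- l)" using A B by linarith
  moreover have "(1 - 2 * l) * l + (2 * l)\<^sup>2 / 16 = u" by (simp add: u_def power2_eq_square field_simps)
  ultimately have AB: "exp ((1 - 2 * l) * l + (2 * l)\<^sup>2 / 16) \<le> 2 - exp (- l)" by simp
  show ?thesis
    by (rule that[of "2 * l"]) (use True assms AB in auto)
next
  case False
  have "exp (- l) \<le> exp (-(1/2))" using False by simp
  also have "exp (-(1/2)) = inverse (exp (1/2::real))" by (simp add: exp_minus)
  also have "exp (1/2::real) \<ge> 1 + 1/2" by (rule exp_ge_add_one_self)
  hence "inverse (exp (1/2::real)) \<le> inverse (1+1/2)" by (intro le_imp_inverse_le) auto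
  finally have A: "exp (- l) \<le> 2/3" by simp
  have B: "exp (1/16::real) \<le> 1 + 1/16 + (1/16)\<^sup>2" by (rule exp_bound) auto
  show ?thesis by (rule that[of 1]) (use A B in \<open>auto simp: power2_eq_square\<close>)
qed

section \<open>The exponential inequality for infimal convolutions\<close>

text \<open>Here \<open>G\<close> stands for the infimal convolution at the section \<open>z\<close>, and \<open>F\<close>, \<open>F'\<close> for those of
  the sections at \<open>z\<close> and \<open>w\<close> in one variable less, for which the inequality is known. Normalising
  \<open>F\<close> and \<open>F'\<close> by \<open>q\<close> and \<open>p\<close> before using the convexity of \<open>exp\<close> replaces
  Hoelder's inequality: both normalised integrals are at most \<open>1\<close>, hence so is their mean.\<close>
lemma section_pair_bound:
  fixes N :: "'b measure" and F F' G :: "'b \<Rightarrow> real" and p q :: real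
  assumes [measurable]: "F \<in> borel_measurable N" "F' \<in> borel_measurable N" "G \<in> borel_measurable N"
    and pq: "0 < q" "q \<le> p"
    and F: "(\<integral>\<^sup>+x. ennreal (exp (F x)) \<partial>N) * ennreal q \<le> 1"
    and F': "(\<integral>\<^sup>+x. ennreal (exp (F' x)) \<partial>N) * ennreal p \<le> 1"
    and G: "\<And>\<theta> x. 0 \<le> \<theta> \<Longrightarrow> \<theta> \<le> 1 \<Longrightarrow> G x \<le> \<theta> * F' x + (1 - \<theta>) * F x + \<theta>\<^sup>2 / 16"
  shows "(\<integral>\<^sup>+x. ennreal (exp (G x)) \<partial>N) * ennreal p \<le> ennreal (2 - q / p)"
proof -
  define l where "l = ln p - ln q"
  have p: "0 < p" using pq by simp
  have l: "0 \<le> l" "exp (- l) = q / p"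
    using pq p by (auto simp: l_def exp_diff)
  obtain \<theta> where th: "0 \<le> \<theta>" "\<theta> \<le> 1" and C: "exp ((1 - \<theta>) * l + \<theta>\<^sup>2 / 16) \<le> 2 - q / p"
    using exists_interpolation_weight[OF l(1)] l(2) by metis
  define C where "C = exp ((1 - \<theta>) * l + \<theta>\<^sup>2 / 16)"
  have pt: "exp (G x) * p \<le> C * (\<theta> * (exp (F' x) * p) + (1 - \<theta>) * (exp (F x) * q))" for x
  proof -
    have "exp (G x) * p = exp (G x + ln p)" using p by (simp add: exp_add)
    also have "G x + ln p \<le> ((1 - \<theta>) * l + \<theta>\<^sup>2 / 16) + (\<theta> * (F' x + ln p) + (1 - \<theta>) * (F x + ln q))"
      using G[OF th, of x] by (simp add: l_def algebra_simps)
    hence "exp (G x + ln p) \<le> C * exp (\<theta> * (F' x + ln p) + (1 - \<theta>) * (F x + ln q))"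
      unfolding C_def exp_add[symmetric] by simp
    also have "exp (\<theta> * (F' x + ln p) + (1 - \<theta>) * (F x + ln q))
        \<le> \<theta> * exp (F' x + ln p) + (1 - \<theta>) * exp (F x + ln q)"
      using convex_onD[OF exp_convex, of \<theta> "F x + ln q" "F' x + ln p"] th by (simp add: algebra_simps)
    also have "\<dots> = \<theta> * (exp (F' x) * p) + (1 - \<theta>) * (exp (F x) * q)"
      using pq p by (simp add: exp_add)
    finally show ?thesis by (simp add: C_def)
  qed
  have C0: "0 \<le> C" by (simp add: C_def)
  have "(\<integral>\<^sup>+x. ennreal (exp (G x)) \<partial>N) * ennreal p = (\<integral>\<^sup>+x. ennreal (exp (G x) * p) \<partial>N)"
    using p by (simp add: nn_integral_multc ennreal_mult)
  also have "\<dots> \<le> (\<integral>\<^sup>+x. ennreal C * (ennreal \<theta> * (ennreal (exp (F' x)) * ennreal p)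
                        + ennreal (1 - \<theta>) * (ennreal (exp (F x)) * ennreal q)) \<partial>N)"
    using pt th p pq C0
    by (intro nn_integral_mono) (simp add: ennreal_mult[symmetric] ennreal_plus[symmetric] del: ennreal_plus)
  also have "\<dots> = ennreal C * (ennreal \<theta> * ((\<integral>\<^sup>+x. ennreal (exp (F' x)) \<partial>N) * ennreal p)
                  + ennreal (1 - \<theta>) * ((\<integral>\<^sup>+x. ennreal (exp (F x)) \<partial>N) * ennreal q))"
    by (simp add: nn_integral_cmult nn_integral_add nn_integral_multc)
  also have "\<dots> \<le> ennreal C * (ennreal \<theta> * 1 + ennreal (1 - \<theta>) * 1)"
    by (intro mult_left_mono add_mono F F') auto
  also have "\<dots> = ennreal C"
    using th by (simp add: ennreal_plus[symmetric] del: ennreal_plus)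
  also have "\<dots> \<le> ennreal (2 - q / p)" using C by (simp add: C_def ennreal_leI)
  finally show ?thesis .
qed

text \<open>For the section with the smaller value of \<open>\<phi>\<close> the previous bound gives \<open>2 - r\<close>, with \<open>r \<le> 1\<close> the ratio of
  the values of \<open>\<phi>\<close>; for the other one the weight \<open>\<theta> = 0\<close> gives \<open>r\<close>. Stated for pairs, the estimate can be
  integrated over \<open>z\<close> and \<open>w\<close> directly, without a section of maximal \<open>\<phi>\<close>.\<close>
lemma section_pair_symmetric:
  fixes F G :: "'z \<Rightarrow> 'b \<Rightarrow> real" and \<phi> :: "'z \<Rightarrow> real"
  assumes F: "\<And>z. F z \<in> borel_measurable N"
    and G: "\<And>z. G z \<in> borel_measurable N"
    and \<phi>: "\<And>z. 0 < \<phi> z" "\<And>z. (\<integral>\<^sup>+x. ennreal (exp (F z x)) \<partial>N) * ennreal (\<phi> z) \<le> 1"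
    and G1: "\<And>\<theta> x. 0 \<le> \<theta> \<Longrightarrow> \<theta> \<le> 1 \<Longrightarrow> G z x \<le> \<theta> * F w x + (1 - \<theta>) * F z x + \<theta>\<^sup>2 / 16"
    and G2: "\<And>\<theta> x. 0 \<le> \<theta> \<Longrightarrow> \<theta> \<le> 1 \<Longrightarrow> G w x \<le> \<theta> * F z x + (1 - \<theta>) * F w x + \<theta>\<^sup>2 / 16"
  shows "(\<integral>\<^sup>+x. ennreal (exp (G z x)) \<partial>N) * ennreal (\<phi> w)
       + (\<integral>\<^sup>+x. ennreal (exp (G w x)) \<partial>N) * ennreal (\<phi> z) \<le> 2"
proof -
  have *: "(\<integral>\<^sup>+x. ennreal (exp (G z x)) \<partial>N) * ennreal (\<phi> w)
       + (\<integral>\<^sup>+x. ennreal (exp (G w x)) \<partial>N) * ennreal (\<phi> z) \<le> 2"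
    if le: "\<phi> z \<le> \<phi> w"
      and G1: "\<And>\<theta> x. 0 \<le> \<theta> \<Longrightarrow> \<theta> \<le> 1 \<Longrightarrow> G z x \<le> \<theta> * F w x + (1 - \<theta>) * F z x + \<theta>\<^sup>2 / 16"
      and G2: "\<And>\<theta> x. 0 \<le> \<theta> \<Longrightarrow> \<theta> \<le> 1 \<Longrightarrow> G w x \<le> \<theta> * F z x + (1 - \<theta>) * F w x + \<theta>\<^sup>2 / 16" for z w
  proof -
    have r: "0 < \<phi> z / \<phi> w" "\<phi> z / \<phi> w \<le> 1" using \<phi>(1)[of z] \<phi>(1)[of w] le by auto
    have 1: "(\<integral>\<^sup>+x. ennreal (exp (G z x)) \<partial>N) * ennreal (\<phi> w) \<le> ennreal (2 - \<phi> z / \<phi> w)"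
      by (rule section_pair_bound[where F = "F z" and F' = "F w"]) (use F G \<phi> le G1 in auto)
    have "(\<integral>\<^sup>+x. ennreal (exp (G w x)) \<partial>N) * ennreal (\<phi> z)
        \<le> (\<integral>\<^sup>+x. ennreal (exp (F w x)) \<partial>N) * (ennreal (\<phi> w) * ennreal (\<phi> z / \<phi> w))"
    proof (rule mult_mono)
      show "(\<integral>\<^sup>+x. ennreal (exp (G w x)) \<partial>N) \<le> (\<integral>\<^sup>+x. ennreal (exp (F w x)) \<partial>N)"
        using G2[of 0] by (intro nn_integral_mono ennreal_leI) simp
      show "ennreal (\<phi> z) \<le> ennreal (\<phi> w) * ennreal (\<phi> z / \<phi> w)"
        using \<phi>(1)[of z] \<phi>(1)[of w] by (simp add: ennreal_mult[symmetric])
    qed auto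
    also have "\<dots> = ((\<integral>\<^sup>+x. ennreal (exp (F w x)) \<partial>N) * ennreal (\<phi> w)) * ennreal (\<phi> z / \<phi> w)"
      by (simp add: mult.assoc)
    also have "\<dots> \<le> 1 * ennreal (\<phi> z / \<phi> w)"
      by (intro mult_right_mono \<phi>) auto
    finally have 2: "(\<integral>\<^sup>+x. ennreal (exp (G w x)) \<partial>N) * ennreal (\<phi> z) \<le> ennreal (\<phi> z / \<phi> w)" by simp
    have "ennreal (2 - \<phi> z / \<phi> w) + ennreal (\<phi> z / \<phi> w) = ennreal 2"
      using r by (subst ennreal_plus[symmetric]) auto
    thus ?thesis using add_mono[OF 1 2] by simp
  qed
  show ?thesis
  proof (cases "\<phi> z \<le> \<phi> w")
    case True thus ?thesis using *[of z w] G1 G2 by blast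
  next
    case False thus ?thesis using *[of w z] G1 G2 by (simp add: add.commute)
  qed
qed

text \<open>Maurey's property for product measures on a cube of side \<open>2 b\<close>, by induction on the number of
  coordinates. Write \<open>\<Phi> z\<close> and \<open>\<Psi> z\<close> for the integrals over the section at \<open>z\<close> of \<open>exp (- f)\<close>
  and of the exponential of the infimal convolution. The induction hypothesis on sections gives
  \<open>\<Psi> z * \<Phi> w + \<Psi> w * \<Phi> z \<le> 2\<close>, and the double integral of the left-hand side is twice the product of
  the two integrals.\<close>
theorem inf_conv_exp_integral:
  fixes \<mu> :: "'i::countable \<Rightarrow> real measure"
  assumes \<mu>: "\<And>i. prob_space (\<mu> i)" "\<And>i. sets (\<mu> i) = sets borel" "\<And>i. AE z in \<mu> i. \<bar>z\<bar> \<le> b"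
    and b: "0 < b" and I: "finite I"
    and f: "convex_fun f" "lipschitz_in I L f" "\<And>x. 0 \<le> f x"
  shows "(\<integral>\<^sup>+x. ennreal (exp (inf_conv (1 / (64 * b\<^sup>2)) I f x)) \<partial>PiM I \<mu>)
         * (\<integral>\<^sup>+x. ennreal (exp (- f x)) \<partial>PiM I \<mu>) \<le> 1"
  using I f
proof (induction I arbitrary: f)
  case empty
  interpret product_prob_space \<mu> by (rule product_prob_spaceI) (rule \<mu>)
  define x0 :: "'i \<Rightarrow> real" where "x0 = (\<lambda>_. undefined)"
  have "inf_conv (1 / (64 * b\<^sup>2)) {} f x0 \<le> f x0"
    using inf_conv_le[of f "1 / (64 * b\<^sup>2)" "{}" x0 x0] empty by simp
  hence "exp (inf_conv (1 / (64 * b\<^sup>2)) {} f x0) * exp (- f x0) \<le> 1"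
    by (simp flip: exp_add)
  thus ?case
    by (simp add: PiM_empty nn_integral_count_space_finite ennreal_mult[symmetric] flip: x0_def)
next
  case (insert i I f)
  interpret product_prob_space \<mu> by (rule product_prob_spaceI) (rule \<mu>)
  interpret I: prob_space "PiM I \<mu>" by (rule prob_space_PiM) (rule \<mu>)
  let ?c = "1 / (64 * b\<^sup>2)"
  define F where "F z = inf_conv ?c I (\<lambda>y. f (y(i := z)))" for z
  define G where "G z x = inf_conv ?c (insert i I) f (x(i := z))" for z x
  define \<Phi> where "\<Phi> z = (\<integral>\<^sup>+x. ennreal (exp (- f (x(i := z)))) \<partial>PiM I \<mu>)" for z
  define \<Psi> where "\<Psi> z = (\<integral>\<^sup>+x. ennreal (exp (G z x)) \<partial>PiM I \<mu>)" for z
  have c0: "0 \<le> ?c" by simp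
  have fm[measurable]: "f \<in> borel_measurable (PiM (insert i I) \<mu>)"
    by (rule lipschitz_in_measurable[OF insert.prems(2) \<mu>(2)])
  have Qm[measurable]: "inf_conv ?c (insert i I) f \<in> borel_measurable (PiM (insert i I) \<mu>)"
    by (rule lipschitz_in_measurable[OF inf_conv_lipschitz \<mu>(2)]) (use insert.prems in auto)
  have cvz: "convex_fun (\<lambda>y. f (y(i := z)))" for z
    unfolding convex_fun_def
  proof (intro allI impI)
    fix x y :: "'i \<Rightarrow> real" and u v :: real
    assume uv: "0 \<le> u" "0 \<le> v" "u + v = 1"
    have *: "(\<lambda>j. u * x j + v * y j)(i := z) = (\<lambda>j. u * (x(i := z)) j + v * (y(i := z)) j)"
      using uv(3) by (auto simp: fun_eq_iff simp flip: distrib_right)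
    show "f ((\<lambda>j. u * x j + v * y j)(i := z)) \<le> u * f (x(i := z)) + v * f (y(i := z))"
      unfolding * using insert.prems(1)[unfolded convex_fun_def, rule_format, OF uv] .
  qed
  have lipz: "lipschitz_in I L (\<lambda>y. f (y(i := z)))" for z
    unfolding lipschitz_in_def
  proof (intro allI)
    fix x y :: "'i \<Rightarrow> real"
    have "\<bar>f (x(i := z)) - f (y(i := z))\<bar> \<le> L * L2_set (\<lambda>j. (x(i := z)) j - (y(i := z)) j) (insert i I)"
      using insert.prems(2) unfolding lipschitz_in_def by blast
    also have "L2_set (\<lambda>j. (x(i := z)) j - (y(i := z)) j) (insert i I) = L2_set (\<lambda>j. x j - y j) I"
      using insert.hyps by (auto simp: L2_set_def intro!: sum.cong)
    finally show "\<bar>f (x(i := z)) - f (y(i := z))\<bar> \<le> L * L2_set (\<lambda>j. x j - y j) I" .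
  qed
  have fzm[measurable]: "(\<lambda>x. f (x(i := z))) \<in> borel_measurable (PiM I \<mu>)" for z
    by (rule lipschitz_in_measurable[OF lipz \<mu>(2)])
  have Fm: "F z \<in> borel_measurable (PiM I \<mu>)" for z
    unfolding F_def
    by (rule lipschitz_in_measurable[OF inf_conv_lipschitz[OF lipz] \<mu>(2)]) (use insert.prems in auto)
  have upd: "(\<lambda>x. x(i := z)) \<in> measurable (PiM I \<mu>) (PiM (insert i I) \<mu>)" for z
    by (rule measurable_fun_upd[where J = I]) (auto simp: sets_eq_imp_space_eq[OF \<mu>(2)] \<mu>(2))
  have Gm: "G z \<in> borel_measurable (PiM I \<mu>)" for z
    unfolding G_def using measurable_compose[OF upd Qm] by simp
  have \<Phi>le: "\<Phi> z \<le> 1" for z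
  proof -
    have "\<Phi> z \<le> (\<integral>\<^sup>+x. 1 \<partial>PiM I \<mu>)" unfolding \<Phi>_def
      by (rule nn_integral_mono) (use insert.prems in simp)
    thus ?thesis by (simp add: I.emeasure_space_1)
  qed
  have \<Phi>pos: "0 < \<Phi> z" for z
  proof -
    have "\<Phi> z \<noteq> 0" unfolding \<Phi>_def
      by (subst nn_integral_0_iff_AE) (auto simp: I.AE_False)
    thus ?thesis by (simp add: zero_less_iff_neq_zero)
  qed
  define \<phi> where "\<phi> z = enn2real (\<Phi> z)" for z
  have \<phi>: "\<Phi> z = ennreal (\<phi> z)" "0 < \<phi> z" for z
  proof -
    have "\<Phi> z < \<top>" using le_less_trans[OF \<Phi>le[of z]] by simp
    thus "\<Phi> z = ennreal (\<phi> z)" "0 < \<phi> z"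
      using \<Phi>pos[of z] by (auto simp: \<phi>_def enn2real_positive_iff)
  qed
  have IH: "(\<integral>\<^sup>+x. ennreal (exp (F z x)) \<partial>PiM I \<mu>) * ennreal (\<phi> z) \<le> 1" for z
    unfolding F_def \<phi>(1)[symmetric] \<Phi>_def
    by (rule insert.IH[OF cvz lipz]) (use insert.prems in auto)
  have Gint: "G z x \<le> \<theta> * F w x + (1 - \<theta>) * F z x + \<theta>\<^sup>2 / 16"
    if zw: "\<bar>z\<bar> \<le> b" "\<bar>w\<bar> \<le> b" and th: "0 \<le> \<theta>" "\<theta> \<le> 1" for z w x \<theta>
  proof -
    \<comment> \<open>the constant \<open>64\<close> turns the cost of crossing the whole interval into \<open>\<theta>\<^sup>2 / 16\<close>\<close>
    have "(z - w)\<^sup>2 \<le> (2 * b)\<^sup>2" using zw b by (intro power2_le_iff_abs_le[THEN iffD2]) auto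
    hence "?c * (\<theta>\<^sup>2 * (z - w)\<^sup>2) \<le> ?c * (\<theta>\<^sup>2 * (2 * b)\<^sup>2)" by (intro mult_left_mono) auto
    also have "\<dots> = \<theta>\<^sup>2 / 16" using b by (simp add: field_simps power2_eq_square)
    finally show ?thesis
      using inf_conv_interpolate[OF insert.prems(1,3) c0 insert.hyps(2,1) th, of x z w]
      unfolding F_def G_def by linarith
  qed
  have pair: "\<Psi> z * \<Phi> w + \<Psi> w * \<Phi> z \<le> 2" if "\<bar>z\<bar> \<le> b" "\<bar>w\<bar> \<le> b" for z w
    unfolding \<Psi>_def \<phi>(1)
    by (rule section_pair_symmetric[where F = F]) (use Fm Gm \<phi>(2) IH Gint that in auto)
  have swap: "(\<lambda>(z, x). x(i := z)) \<in> measurable (\<mu> i \<Otimes>\<^sub>M PiM I \<mu>) (PiM (insert i I) \<mu>)"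
    using measurable_comp[OF measurable_pair_swap' measurable_add_dim[of i I \<mu>]]
    by (simp add: comp_def case_prod_beta')
  have [measurable]: "\<Phi> \<in> borel_measurable (\<mu> i)" "\<Psi> \<in> borel_measurable (\<mu> i)"
    unfolding \<Phi>_def \<Psi>_def G_def
    using measurable_compose[OF swap fm] measurable_compose[OF swap Qm]
    by (auto intro!: I.borel_measurable_nn_integral simp: case_prod_beta')
  have "2 * ((\<integral>\<^sup>+z. \<Psi> z \<partial>\<mu> i) * (\<integral>\<^sup>+w. \<Phi> w \<partial>\<mu> i))
      = (\<integral>\<^sup>+z. \<integral>\<^sup>+w. (\<Psi> z * \<Phi> w + \<Psi> w * \<Phi> z) \<partial>\<mu> i \<partial>\<mu> i)"
    by (simp add: nn_integral_add nn_integral_cmult nn_integral_multc mult_2)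
  also have "\<dots> \<le> (\<integral>\<^sup>+z. \<integral>\<^sup>+w. 2 \<partial>\<mu> i \<partial>\<mu> i)"
  proof (rule nn_integral_mono_AE, use \<mu>(3)[of i] in eventually_elim)
    case (elim z)
    show ?case
      by (rule nn_integral_mono_AE, use \<mu>(3)[of i] in eventually_elim) (use pair elim in auto)
  qed
  also have "\<dots> = 2 * 1" by (simp add: prob_space.emeasure_space_1[OF \<mu>(1)])
  finally have "(\<integral>\<^sup>+z. \<Psi> z \<partial>\<mu> i) * (\<integral>\<^sup>+w. \<Phi> w \<partial>\<mu> i) \<le> 1"
    by (subst (asm) ennreal_mult_le_mult_iff) auto
  thus ?case
    using insert.hyps
    by (subst (1 2) product_nn_integral_insert_rev) (auto simp: \<Phi>_def \<Psi>_def G_def)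
qed

section \<open>Concentration for bounded and for truncated coordinates\<close>

text \<open>The test function is \<open>g = 2 c s (f - a)\<^sup>+\<close>. It vanishes where \<open>f \<le> a\<close>. Where \<open>f \<ge> a + s\<close>, moving by
  \<open>r\<close> costs at least \<open>2 c s (s - r) + c r\<^sup>2 = c s\<^sup>2 + c (s - r)\<^sup>2\<close>, so its infimal convolution is at least
  \<open>c s\<^sup>2\<close>; the slope \<open>2 c s\<close> is chosen to complete this square.\<close>
theorem convex_concentration_bounded:
  fixes \<mu> :: "'i::countable \<Rightarrow> real measure"
  assumes \<mu>: "\<And>i. prob_space (\<mu> i)" "\<And>i. sets (\<mu> i) = sets borel" "\<And>i. AE z in \<mu> i. \<bar>z\<bar> \<le> b"
    and b: "0 < b" and I: "finite I"
    and f: "convex_fun f" "lipschitz_in I 1 f" and s: "0 < s"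
  shows "measure (PiM I \<mu>) {x \<in> space (PiM I \<mu>). f x \<le> a}
         * measure (PiM I \<mu>) {x \<in> space (PiM I \<mu>). f x \<ge> a + s} \<le> exp (- (s\<^sup>2 / (64 * b\<^sup>2)))"
proof -
  interpret I: prob_space "PiM I \<mu>" by (rule prob_space_PiM) (rule \<mu>)
  define c where "c = 1 / (64 * b\<^sup>2)"
  have c: "0 < c" using b by (simp add: c_def)
  define g where "g x = 2 * c * s * max 0 (f x - a)" for x
  have cs: "0 \<le> 2 * c * s" using c s by simp
  have g0: "0 \<le> g x" for x using cs by (simp add: g_def)
  have gcv: "convex_fun g"
    unfolding convex_fun_def
  proof (intro allI impI)
    fix x y :: "'i \<Rightarrow> real" and u v :: real
    assume uv: "0 \<le> u" "0 \<le> v" "u + v = 1"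
    have "f (\<lambda>i. u * x i + v * y i) - a \<le> u * (f x - a) + v * (f y - a)"
      using f(1)[unfolded convex_fun_def, rule_format, OF uv, of x y] uv(3)
      by (simp add: algebra_simps flip: distrib_left)
    moreover have "u * (f x - a) \<le> u * max 0 (f x - a)" "v * (f y - a) \<le> v * max 0 (f y - a)"
      "0 \<le> u * max 0 (f x - a)" "0 \<le> v * max 0 (f y - a)"
      using uv by (auto intro!: mult_left_mono)
    ultimately have "max 0 (f (\<lambda>i. u * x i + v * y i) - a) \<le> u * max 0 (f x - a) + v * max 0 (f y - a)"
      by linarith
    from mult_left_mono[OF this cs] show "g (\<lambda>i. u * x i + v * y i) \<le> u * g x + v * g y"
      unfolding g_def by (simp add: algebra_simps)
  qed
  have glip: "lipschitz_in I (2 * c * s) g"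
    unfolding lipschitz_in_def
  proof (intro allI)
    fix x y
    have "\<bar>max 0 (f x - a) - max 0 (f y - a)\<bar> \<le> \<bar>f x - f y\<bar>" by linarith
    also have "\<dots> \<le> L2_set (\<lambda>i. x i - y i) I" using f(2) by (simp add: lipschitz_in_def)
    finally have "2 * c * s * \<bar>max 0 (f x - a) - max 0 (f y - a)\<bar> \<le> 2 * c * s * L2_set (\<lambda>i. x i - y i) I"
      using cs by (rule mult_left_mono)
    moreover have "\<bar>g x - g y\<bar> = 2 * c * s * \<bar>max 0 (f x - a) - max 0 (f y - a)\<bar>"
      unfolding g_def right_diff_distrib[symmetric] abs_mult[of "2 * c * s"] abs_of_nonneg[OF cs] ..
    ultimately show "\<bar>g x - g y\<bar> \<le> 2 * c * s * L2_set (\<lambda>i. x i - y i) I" by simp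
  qed
  have Qg: "c * s\<^sup>2 \<le> inf_conv c I g x" if x: "a + s \<le> f x" for x
  proof (rule inf_conv_greatest)
    fix y
    define r where "r = L2_set (\<lambda>i. x i - y i) I"
    have "\<bar>f x - f y\<bar> \<le> r" using f(2) by (simp add: lipschitz_in_def r_def)
    hence "s - r \<le> max 0 (f y - a)" using x by linarith
    hence "2 * c * s * (s - r) \<le> g y" unfolding g_def using cs by (rule mult_left_mono)
    moreover have "c * (\<Sum>i\<in>I. (x i - y i)\<^sup>2) = c * r\<^sup>2" unfolding r_def L2_set_def by (simp add: sum_nonneg)
    moreover have "2 * c * s * (s - r) + c * r\<^sup>2 = c * s\<^sup>2 + c * (s - r)\<^sup>2"
      by (simp add: power2_eq_square algebra_simps)
    moreover have "0 \<le> c * (s - r)\<^sup>2" using c by simp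
    ultimately show "c * s\<^sup>2 \<le> g y + c * (\<Sum>i\<in>I. (x i - y i)\<^sup>2)" by linarith
  qed
  have [measurable]: "f \<in> borel_measurable (PiM I \<mu>)"
    by (rule lipschitz_in_measurable[OF f(2) \<mu>(2)])
  let ?A = "{x \<in> space (PiM I \<mu>). f x \<le> a}" and ?B = "{x \<in> space (PiM I \<mu>). f x \<ge> a + s}"
  have A: "emeasure (PiM I \<mu>) ?A \<le> (\<integral>\<^sup>+x. ennreal (exp (- g x)) \<partial>PiM I \<mu>)"
  proof -
    have "emeasure (PiM I \<mu>) ?A = (\<integral>\<^sup>+x. indicator ?A x \<partial>PiM I \<mu>)" by simp
    also have "\<dots> \<le> (\<integral>\<^sup>+x. ennreal (exp (- g x)) \<partial>PiM I \<mu>)"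
      by (intro nn_integral_mono) (auto simp: indicator_def g_def)
    finally show ?thesis .
  qed
  have B: "ennreal (exp (c * s\<^sup>2)) * emeasure (PiM I \<mu>) ?B \<le> (\<integral>\<^sup>+x. ennreal (exp (inf_conv c I g x)) \<partial>PiM I \<mu>)"
  proof -
    have "ennreal (exp (c * s\<^sup>2)) * emeasure (PiM I \<mu>) ?B
        = (\<integral>\<^sup>+x. ennreal (exp (c * s\<^sup>2)) * indicator ?B x \<partial>PiM I \<mu>)"
      by (subst nn_integral_cmult_indicator) auto
    also have "\<dots> \<le> (\<integral>\<^sup>+x. ennreal (exp (inf_conv c I g x)) \<partial>PiM I \<mu>)"
      by (intro nn_integral_mono) (auto simp: indicator_def intro!: ennreal_leI Qg)
    finally show ?thesis .
  qed
  have "ennreal (exp (c * s\<^sup>2)) * emeasure (PiM I \<mu>) ?B * emeasure (PiM I \<mu>) ?A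
      \<le> (\<integral>\<^sup>+x. ennreal (exp (inf_conv c I g x)) \<partial>PiM I \<mu>) * (\<integral>\<^sup>+x. ennreal (exp (- g x)) \<partial>PiM I \<mu>)"
    by (intro mult_mono A B) auto
  also have "\<dots> \<le> 1"
    unfolding c_def using inf_conv_exp_integral[OF \<mu> b I gcv glip g0] .
  finally have "exp (c * s\<^sup>2) * measure (PiM I \<mu>) ?B * measure (PiM I \<mu>) ?A \<le> 1"
    by (simp add: I.emeasure_eq_measure ennreal_mult[symmetric])
  hence "measure (PiM I \<mu>) ?A * measure (PiM I \<mu>) ?B \<le> exp (- (c * s\<^sup>2))"
    by (simp add: exp_minus field_simps)
  thus ?thesis by (simp add: c_def)
qed

context prob_space begin

lemma convex_concentration_indep_bounded:
  fixes Y :: "'i::countable \<Rightarrow> 'a \<Rightarrow> real"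
  assumes Y: "indep_vars (\<lambda>_. borel) Y I" "\<And>i \<omega>. i \<in> I \<Longrightarrow> \<bar>Y i \<omega>\<bar> \<le> b"
    and b: "0 < b" and I: "finite I" "I \<noteq> {}"
    and f: "convex_fun f" "lipschitz_in I 1 f" and s: "0 < s"
  shows "prob {\<omega> \<in> space M. f (\<lambda>i\<in>I. Y i \<omega>) \<le> a} * prob {\<omega> \<in> space M. f (\<lambda>i\<in>I. Y i \<omega>) \<ge> a + s}
     \<le> exp (- (s\<^sup>2 / (64 * b\<^sup>2)))"
proof -
  define Y' where "Y' i = (if i \<in> I then Y i else (\<lambda>_. 0))" for i
  have Ym[measurable]: "Y i \<in> borel_measurable M" if "i \<in> I" for i
    using Y(1) that by (auto simp: indep_vars_def)
  have [measurable]: "Y' i \<in> borel_measurable M" for i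
    by (auto simp: Y'_def)
  define \<mu> where "\<mu> i = distr M borel (Y' i)" for i
  have P: "distr M (PiM I (\<lambda>_. borel)) (\<lambda>\<omega>. \<lambda>i\<in>I. Y i \<omega>) = PiM I \<mu>"
    using indep_vars_iff_distr_eq_PiM'[where I = I and M' = "\<lambda>_. borel" and X = Y] I Y(1) Ym
    by (auto simp: \<mu>_def Y'_def cong: PiM_cong)
  have \<mu>: "prob_space (\<mu> i)" "sets (\<mu> i) = sets borel" for i
    unfolding \<mu>_def by (auto intro: prob_space_distr)
  have "\<bar>Y' i \<omega>\<bar> \<le> b" for i \<omega>
    using Y(2) b by (simp add: Y'_def)
  hence \<mu>b: "AE z in \<mu> i. \<bar>z\<bar> \<le> b" for i
    unfolding \<mu>_def by (subst AE_distr_iff) auto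
  have vm: "(\<lambda>\<omega>. \<lambda>i\<in>I. Y i \<omega>) \<in> measurable M (PiM I (\<lambda>_. borel))"
    using Ym by measurable
  have fm[measurable]: "f \<in> borel_measurable (PiM I (\<lambda>_. borel))"
    by (rule lipschitz_in_measurable[OF f(2)]) simp
  have "prob {\<omega> \<in> space M. f (\<lambda>i\<in>I. Y i \<omega>) \<le> a} = measure (PiM I \<mu>) {x \<in> space (PiM I \<mu>). f x \<le> a}"
    unfolding P[symmetric] using measurable_space[OF vm]
    by (subst measure_distr[OF vm]) (auto intro!: arg_cong[where f = prob])
  moreover have "prob {\<omega> \<in> space M. f (\<lambda>i\<in>I. Y i \<omega>) \<ge> a + s} = measure (PiM I \<mu>) {x \<in> space (PiM I \<mu>). f x \<ge> a + s}"
    unfolding P[symmetric] using measurable_space[OF vm]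
    by (subst measure_distr[OF vm]) (auto intro!: arg_cong[where f = prob])
  ultimately show ?thesis
    using convex_concentration_bounded[OF \<mu> \<mu>b b I(1) f s, where a = a] by simp
qed

text \<open>A coordinate of the excess has \<open>E exp (Z\<^sup>2 / (2 a\<^sup>2)) \<le> 1 + 2 e\<close> with \<open>e = exp (- b\<^sup>2 / (2 a\<^sup>2))\<close>:
  where it is nonzero, half of the exponent \<open>X\<^sup>2 / a\<^sup>2\<close> is given up, and that half is at least
  \<open>b\<^sup>2 / (2 a\<^sup>2)\<close>. Independence multiplies these bounds, and Markov's inequality concludes.\<close>
lemma excess_norm_tail:
  fixes X :: "'i \<Rightarrow> 'a \<Rightarrow> real"
  assumes X: "indep_vars (\<lambda>_. borel) X I" and I: "finite I" and a: "0 < a" and r: "0 \<le> r" and b: "0 \<le> b"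
    and E: "\<And>i. i \<in> I \<Longrightarrow> (\<integral>\<^sup>+\<omega>. ennreal (exp ((X i \<omega>)\<^sup>2 / a\<^sup>2)) \<partial>M) \<le> 2"
  shows "prob {\<omega> \<in> space M. r \<le> L2_set (\<lambda>i. if \<bar>X i \<omega>\<bar> \<le> b then 0 else X i \<omega>) I}
      \<le> exp (2 * real (card I) * exp (- (b\<^sup>2 / (2 * a\<^sup>2))) - r\<^sup>2 / (2 * a\<^sup>2))"
proof -
  define h where "h x = (if \<bar>x\<bar> \<le> b then 0 else x)" for x :: real
  define e where "e = exp (- (b\<^sup>2 / (2 * a\<^sup>2)))"
  define W where "W x = exp ((h x)\<^sup>2 / (2 * a\<^sup>2))" for x
  have [measurable]: "h \<in> borel_measurable borel" unfolding h_def by measurable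
  have Wm[measurable]: "W \<in> borel_measurable borel" unfolding W_def by measurable
  have Xm[measurable]: "X i \<in> borel_measurable M" if "i \<in> I" for i
    using X that by (auto simp: indep_vars_def)
  have pt: "W x \<le> 1 + e * exp (x\<^sup>2 / a\<^sup>2)" for x
  proof (cases "\<bar>x\<bar> \<le> b")
    case True thus ?thesis by (simp add: W_def h_def e_def)
  next
    case False
    hence "b\<^sup>2 \<le> x\<^sup>2" using b by (intro abs_le_square_iff[THEN iffD1]) auto
    hence "x\<^sup>2 / (2 * a\<^sup>2) \<le> - (b\<^sup>2 / (2 * a\<^sup>2)) + x\<^sup>2 / a\<^sup>2" using a by (simp add: field_simps)
    hence "exp (x\<^sup>2 / (2 * a\<^sup>2)) \<le> e * exp (x\<^sup>2 / a\<^sup>2)" unfolding e_def exp_add[symmetric] by simp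
    thus ?thesis using False by (simp add: W_def h_def)
  qed
  have one: "(\<integral>\<^sup>+\<omega>. ennreal (W (X i \<omega>)) \<partial>M) \<le> ennreal (exp (2 * e))" if i: "i \<in> I" for i
  proof -
    have e0: "0 \<le> e" by (simp add: e_def)
    have "(\<integral>\<^sup>+\<omega>. ennreal (W (X i \<omega>)) \<partial>M) \<le> (\<integral>\<^sup>+\<omega>. 1 + ennreal e * ennreal (exp ((X i \<omega>)\<^sup>2 / a\<^sup>2)) \<partial>M)"
      using pt e0 by (intro nn_integral_mono)
         (simp add: ennreal_mult[symmetric] ennreal_plus[symmetric] del: ennreal_plus flip: ennreal_1)
    also have "\<dots> = 1 + ennreal e * (\<integral>\<^sup>+\<omega>. ennreal (exp ((X i \<omega>)\<^sup>2 / a\<^sup>2)) \<partial>M)"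
      using i by (simp add: nn_integral_add nn_integral_cmult emeasure_space_1)
    also have "\<dots> \<le> 1 + ennreal e * 2"
      by (intro add_mono mult_left_mono E i) auto
    also have "\<dots> = ennreal (1 + e * 2)" using e0 by (simp add: ennreal_mult)
    also have "\<dots> \<le> ennreal (exp (2 * e))" by (intro ennreal_leI) (simp add: mult.commute)
    finally show ?thesis .
  qed
  let ?S = "{\<omega> \<in> space M. r \<le> L2_set (\<lambda>i. h (X i \<omega>)) I}"
  have S[measurable]: "?S \<in> sets M" unfolding L2_set_def by measurable
  have "ennreal (exp (r\<^sup>2 / (2 * a\<^sup>2))) * emeasure M ?S = (\<integral>\<^sup>+\<omega>. ennreal (exp (r\<^sup>2 / (2 * a\<^sup>2))) * indicator ?S \<omega> \<partial>M)"
    by (subst nn_integral_cmult_indicator) auto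
  also have "\<dots> \<le> (\<integral>\<^sup>+\<omega>. (\<Prod>i\<in>I. ennreal (W (X i \<omega>))) \<partial>M)"
  proof (intro nn_integral_mono)
    fix \<omega>
    show "ennreal (exp (r\<^sup>2 / (2 * a\<^sup>2))) * indicator ?S \<omega> \<le> (\<Prod>i\<in>I. ennreal (W (X i \<omega>)))"
    proof (cases "\<omega> \<in> ?S")
      case True
      hence "r\<^sup>2 \<le> (L2_set (\<lambda>i. h (X i \<omega>)) I)\<^sup>2" using r by (intro power_mono) auto
      also have "\<dots> = (\<Sum>i\<in>I. (h (X i \<omega>))\<^sup>2)" unfolding L2_set_def by (simp add: sum_nonneg)
      finally have "exp (r\<^sup>2 / (2 * a\<^sup>2)) \<le> exp ((\<Sum>i\<in>I. (h (X i \<omega>))\<^sup>2) / (2 * a\<^sup>2))"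
        using a by (simp add: divide_right_mono)
      also have "\<dots> = (\<Prod>i\<in>I. W (X i \<omega>))"
        unfolding W_def by (simp add: sum_divide_distrib exp_sum I)
      finally show ?thesis using True
        by (simp add: prod_ennreal W_def ennreal_leI)
    qed simp
  qed
  also have "\<dots> = (\<Prod>i\<in>I. \<integral>\<^sup>+\<omega>. ennreal (W (X i \<omega>)) \<partial>M)"
    by (rule indep_vars_nn_integral[OF I indep_vars_compose2[OF X]]) auto
  also have "\<dots> \<le> (\<Prod>i\<in>I. ennreal (exp (2 * e)))" 
    using I one by (induction I rule: finite_induct) (auto intro!: mult_mono)
  also have "\<dots> = ennreal (exp (2 * real (card I) * e))"
    by (simp add: ennreal_power exp_of_nat_mult[symmetric] mult_ac)
  finally have "exp (r\<^sup>2 / (2 * a\<^sup>2)) * prob ?S \<le> exp (2 * real (card I) * e)"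
    by (simp add: emeasure_eq_measure ennreal_mult[symmetric])
  hence "prob ?S \<le> exp (2 * real (card I) * e - r\<^sup>2 / (2 * a\<^sup>2))"
    by (simp add: exp_diff field_simps)
  thus ?thesis by (simp add: h_def e_def)
qed

end

section \<open>Subgaussian coordinates\<close>

text \<open>The threshold is such that below it \<open>exp (- (w / 163840))\<close> is at least \<open>exp (- 1/2) \<ge> 1/2\<close>, and above it
  an eighth of the exponent is kept while the other seven eighths, at least \<open>7/2\<close>, outweigh the factor \<open>5\<close>.\<close>
lemma absorb_constant:
  fixes p w :: real
  assumes p: "p \<le> 1/2" and w: "81920 < w \<Longrightarrow> p \<le> 5 * exp (- (w / 20480))"
  shows "p \<le> exp (- (w / 163840))"
proof (cases "81920 < w")
  case False
  have "1 + (- (1/2)) \<le> exp (- (1/2) :: real)" by (rule exp_ge_add_one_self)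
  also have "\<dots> \<le> exp (- (w / 163840))" using False by simp
  finally show ?thesis using p by simp
next
  case True
  define z where "z = 7 * w / 163840"
  have z: "7/2 \<le> z" using True by (simp add: z_def)
  hence "(7/2)\<^sup>2 \<le> z\<^sup>2" by (intro power_mono) auto
  hence "5 \<le> 1 + z + z\<^sup>2 / 2" using z by (simp add: power2_eq_square)
  also have "\<dots> \<le> exp z" using z by (intro exp_lower_Taylor_quadratic) simp
  finally have "5 * exp (- (w / 20480)) \<le> exp z * exp (- (w / 20480))" by simp
  also have "\<dots> = exp (- (w / 163840))" by (simp add: z_def flip: exp_add)
  finally show ?thesis using w[OF True] by simp
qed

lemma ln_affine_le:
  fixes x :: real assumes "0 \<le> x"
  shows "ln (2 + 512 * x) \<le> 10 * ln (2 + x)"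
proof -
  have "(2::real) ^ 9 \<le> (2 + x) ^ 9" using assms by (intro power_mono) auto
  hence "2 ^ 9 * (2 + x) \<le> (2 + x) ^ 9 * (2 + x)" using assms by (intro mult_right_mono) auto
  also have "\<dots> = (2 + x) ^ 10" by (simp add: power_Suc[symmetric] mult.commute)
  finally have "2 + 512 * x \<le> (2 + x) ^ 10" by simp
  hence "ln (2 + 512 * x) \<le> ln ((2 + x) ^ 10)" using assms by (subst ln_le_cancel_iff) auto
  also have "\<dots> = 10 * ln (2 + x)" using assms by (simp add: ln_realpow)
  finally show ?thesis .
qed

lemma half_le_ln_2_plus:
  fixes x :: real assumes "0 \<le> x" shows "1/2 \<le> ln (2 + x)"
proof -
  have "exp (1/2::real) \<le> 1 + 1/2 + (1/2)\<^sup>2" by (rule exp_bound) auto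
  also have "\<dots> \<le> 2 + x" using assms by (simp add: power2_eq_square)
  finally show ?thesis using assms by (subst ln_ge_iff) auto
qed

text \<open>The factor \<open>2\<close> only serves to lie strictly above the infimum, where some admissible \<open>l\<close>
  can be picked without discussing whether the infimum is attained.\<close>
lemma subgaussian_exp_square:
  assumes "subgaussian M K Y" "0 < K"
  shows "(\<integral>\<^sup>+\<omega>. ennreal (exp ((Y \<omega>)\<^sup>2 / (2 * K)\<^sup>2)) \<partial>M) \<le> 2"
proof -
  have "psi2_norm M Y < ennreal (2 * K)"
    using assms by (auto simp: subgaussian_def intro!: le_less_trans[of _ "ennreal K"] ennreal_lessI)
  then obtain l where l: "0 < l" "ennreal l < ennreal (2 * K)"
      "(\<integral>\<^sup>+\<omega>. ennreal (exp ((Y \<omega>)\<^sup>2 / l\<^sup>2)) \<partial>M) \<le> 2"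
    unfolding psi2_norm_def Inf_less_iff by auto
  have "l \<le> 2 * K" using l(2) assms(2) by (metis ennreal_le_iff less_imp_le mult_nonneg_nonneg zero_le_numeral)
  hence "l\<^sup>2 \<le> (2 * K)\<^sup>2" using l(1) by (intro power_mono) auto
  hence "(\<integral>\<^sup>+\<omega>. ennreal (exp ((Y \<omega>)\<^sup>2 / (2 * K)\<^sup>2)) \<partial>M) \<le> (\<integral>\<^sup>+\<omega>. ennreal (exp ((Y \<omega>)\<^sup>2 / l\<^sup>2)) \<partial>M)"
    using l(1) assms(2) by (intro nn_integral_mono ennreal_leI) (auto intro!: divide_left_mono mult_pos_pos)
  thus ?thesis using l(3) by simp
qed

context prob_space begin

text \<open>The median of \<open>E\<close> shows that \<open>G\<close> lies below \<open>m + t / 4\<close>, and above \<open>m - t / 4\<close>, with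
  probability at least \<open>1/2 - q \<ge> 1/4\<close> each. Dividing the product bound by this factor controls deviations of
  \<open>G\<close> by \<open>3 t / 4\<close> from \<open>m\<close>, and those of \<open>E\<close> by \<open>t\<close> up to the event \<open>R \<ge> t / 4\<close>.\<close>
lemma tails_from_truncation:
  fixes E G R :: "'a \<Rightarrow> real"
  assumes meas[measurable]: "E \<in> borel_measurable M" "G \<in> borel_measurable M" "R \<in> borel_measurable M"
    and close: "\<And>\<omega>. \<bar>E \<omega> - G \<omega>\<bar> \<le> R \<omega>"
    and med: "is_median M E m" and t: "0 < t"
    and R: "prob {\<omega> \<in> space M. t / 4 \<le> R \<omega>} \<le> q" and q: "q \<le> 1/4"
    and G: "\<And>a. prob {\<omega> \<in> space M. G \<omega> \<le> a} * prob {\<omega> \<in> space M. G \<omega> \<ge> a + t / 2} \<le> d"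
  shows "prob {\<omega> \<in> space M. E \<omega> - m \<ge> t} \<le> 4 * d + q"
    and "prob {\<omega> \<in> space M. E \<omega> - m \<le> - t} \<le> 4 * d + q"
proof -
  let ?Q = "{\<omega> \<in> space M. t / 4 \<le> R \<omega>}"
  have *: "prob A \<le> prob B + q" if "A \<subseteq> B \<union> ?Q" "B \<in> sets M" for A B
  proof -
    have "prob A \<le> prob (B \<union> ?Q)" using that by (intro finite_measure_mono) auto
    also have "\<dots> \<le> prob B + prob ?Q" using that by (intro measure_Un_le) auto
    finally show ?thesis using R by simp
  qed
  have sub: "{\<omega> \<in> space M. P (E \<omega>)} \<subseteq> {\<omega> \<in> space M. P' (G \<omega>)} \<union> ?Q"
    if "\<And>u v. P u \<Longrightarrow> \<bar>u - v\<bar> < t / 4 \<Longrightarrow> P' v" for P P' :: "real \<Rightarrow> bool"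
  proof
    fix \<omega> assume \<omega>: "\<omega> \<in> {\<omega> \<in> space M. P (E \<omega>)}"
    show "\<omega> \<in> {\<omega> \<in> space M. P' (G \<omega>)} \<union> ?Q"
    proof (cases "t / 4 \<le> R \<omega>")
      case False
      hence "\<bar>E \<omega> - G \<omega>\<bar> < t / 4" using close[of \<omega>] by linarith
      thus ?thesis using \<omega> that by blast
    qed (use \<omega> in simp)
  qed
  have quarter: "x \<le> 4 * d" if "1/4 \<le> y" "y * x \<le> d" "0 \<le> x" for x y :: real
    using mult_right_mono[OF that(1,3)] that(2) by simp
  have "1/2 \<le> prob {\<omega> \<in> space M. E \<omega> \<le> m}" using med by (simp add: is_median_def)
  also have "\<dots> \<le> prob {\<omega> \<in> space M. G \<omega> \<le> m + t / 4} + q"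
    by (rule *[OF sub]) (linarith, measurable)
  finally have 1: "1/4 \<le> prob {\<omega> \<in> space M. G \<omega> \<le> m + t / 4}" using q by simp
  have "prob {\<omega> \<in> space M. E \<omega> - m \<ge> t} \<le> prob {\<omega> \<in> space M. G \<omega> \<ge> m + t / 4 + t / 2} + q"
    by (rule *[OF sub]) (linarith, measurable)
  also have "prob {\<omega> \<in> space M. G \<omega> \<ge> m + t / 4 + t / 2} \<le> 4 * d"
    by (rule quarter[OF 1 G]) simp
  finally show "prob {\<omega> \<in> space M. E \<omega> - m \<ge> t} \<le> 4 * d + q" by simp
  have "1/2 \<le> prob {\<omega> \<in> space M. E \<omega> \<ge> m}" using med by (simp add: is_median_def)
  also have "\<dots> \<le> prob {\<omega> \<in> space M. G \<omega> \<ge> m - 3 * t / 4 + t / 2} + q"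
    by (rule *[OF sub]) (linarith, measurable)
  finally have 2: "1/4 \<le> prob {\<omega> \<in> space M. G \<omega> \<ge> m - 3 * t / 4 + t / 2}" using q by simp
  have "prob {\<omega> \<in> space M. E \<omega> - m \<le> - t} \<le> prob {\<omega> \<in> space M. G \<omega> \<le> m - 3 * t / 4} + q"
    by (rule *[OF sub]) (linarith, measurable)
  also have "prob {\<omega> \<in> space M. G \<omega> \<le> m - 3 * t / 4} \<le> 4 * d"
    by (rule quarter[OF 2]) (use G[of "m - 3 * t / 4"] in \<open>simp_all add: mult.commute\<close>)
  finally show "prob {\<omega> \<in> space M. E \<omega> - m \<le> - t} \<le> 4 * d + q" by simp
qed

lemma median_tails_le_half:
  assumes [measurable]: "E \<in> borel_measurable M" and med: "is_median M E m" and t: "0 < t"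
  shows "prob {\<omega> \<in> space M. E \<omega> - m \<ge> t} \<le> 1/2" "prob {\<omega> \<in> space M. E \<omega> - m \<le> - t} \<le> 1/2"
proof -
  have *: "prob A \<le> 1/2" if "A \<subseteq> space M - B" "1/2 \<le> prob B" "B \<in> sets M" for A B
  proof -
    have "prob A \<le> prob (space M - B)" using that by (intro finite_measure_mono) auto
    also have "\<dots> = 1 - prob B" using that by (intro prob_compl)
    finally show ?thesis using that(2) by simp
  qed
  show "prob {\<omega> \<in> space M. E \<omega> - m \<ge> t} \<le> 1/2"
    by (rule *[of _ "{\<omega> \<in> space M. E \<omega> \<le> m}"]) (use med t in \<open>auto simp: is_median_def\<close>)
  show "prob {\<omega> \<in> space M. E \<omega> - m \<le> - t} \<le> 1/2"
    by (rule *[of _ "{\<omega> \<in> space M. E \<omega> \<ge> m}"]) (use med t in \<open>auto simp: is_median_def\<close>)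
qed

text \<open>The truncation level satisfies \<open>exp (b\<^sup>2 / (8 K\<^sup>2)) = 2 + 512 K\<^sup>2 n / t\<^sup>2\<close>. The factor \<open>512\<close> makes
  \<open>2 n exp (- b\<^sup>2 / (8 K\<^sup>2))\<close> at most half of the Markov exponent \<open>(t / 4)\<^sup>2 / (8 K\<^sup>2)\<close>, and inside the
  logarithm it costs no more than the factor of \<open>ln_affine_le\<close>.\<close>
theorem convex_concentration_subgaussian:
  fixes X :: "'i::countable \<Rightarrow> 'a \<Rightarrow> real"
  assumes X: "indep_vars (\<lambda>_. borel) X I" "\<And>i. i \<in> I \<Longrightarrow> subgaussian M K (X i)"
    and K: "0 < K" and I: "finite I" "I \<noteq> {}"
    and f: "convex_fun f" "lipschitz_in I 1 f" and t: "0 < t"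
    and med: "is_median M (\<lambda>\<omega>. f (\<lambda>i\<in>I. X i \<omega>)) m"
  defines "rate \<equiv> t\<^sup>2 / (K\<^sup>2 * ln (2 + K\<^sup>2 * real (card I) / t\<^sup>2)) / 163840"
  shows "prob {\<omega> \<in> space M. f (\<lambda>i\<in>I. X i \<omega>) - m \<ge> t} \<le> exp (- rate)"
    and "prob {\<omega> \<in> space M. f (\<lambda>i\<in>I. X i \<omega>) - m \<le> - t} \<le> exp (- rate)"
proof -
  define n where "n = real (card I)"
  define x where "x = K\<^sup>2 * n / t\<^sup>2"
  define w where "w = t\<^sup>2 / (K\<^sup>2 * ln (2 + x))"
  have n: "0 < n" using I by (simp add: n_def card_gt_0_iff)
  have x: "0 < x" using n K t by (simp add: x_def)
  have rate: "rate = w / 163840" by (simp add: rate_def w_def x_def n_def)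
  have L: "1/2 \<le> ln (2 + x)" using half_le_ln_2_plus[of x] x by simp
  \<comment> \<open>\<open>w\<close> is the exponent of the theorem without its constant; the two terms of the tail bound decay at rates \<open>w / 20480\<close> and \<open>w / 512\<close>\<close>
  define b where "b = sqrt (8 * K\<^sup>2 * ln (2 + 512 * x))"
  have l512: "0 < ln (2 + 512 * x)" using x by simp
  have b2: "b\<^sup>2 = 8 * K\<^sup>2 * ln (2 + 512 * x)" using l512 K by (simp add: b_def)
  have b: "0 < b" using l512 K by (simp add: b_def)
  have bw: "w / 20480 \<le> (t / 2)\<^sup>2 / (64 * b\<^sup>2)"
  proof -
    have "b\<^sup>2 \<le> 8 * K\<^sup>2 * (10 * ln (2 + x))"
      unfolding b2 using ln_affine_le[of x] x by (intro mult_left_mono) auto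
    hence "t\<^sup>2 / (256 * (8 * K\<^sup>2 * (10 * ln (2 + x)))) \<le> t\<^sup>2 / (256 * b\<^sup>2)"
      using b K L by (intro divide_left_mono mult_pos_pos) auto
    thus ?thesis by (simp add: w_def power_divide)
  qed
  have Kw: "w / 512 \<le> t\<^sup>2 / (256 * K\<^sup>2)"
  proof -
    have "t\<^sup>2 / (512 * K\<^sup>2 * ln (2 + x)) \<le> t\<^sup>2 / (512 * K\<^sup>2 * (1/2))"
      using K L by (intro divide_left_mono mult_left_mono mult_pos_pos) auto
    thus ?thesis by (simp add: w_def mult_ac)
  qed
  define h where "h z = (if \<bar>z\<bar> \<le> b then z else 0)" for z
  define Y where "Y i \<omega> = h (X i \<omega>)" for i \<omega>
  define R where "R \<omega> = L2_set (\<lambda>i. if \<bar>X i \<omega>\<bar> \<le> b then 0 else X i \<omega>) I" for \<omega>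
  let ?E = "\<lambda>\<omega>. f (\<lambda>i\<in>I. X i \<omega>)" and ?G = "\<lambda>\<omega>. f (\<lambda>i\<in>I. Y i \<omega>)"
  have hm: "h \<in> borel_measurable borel" unfolding h_def by measurable
  have Xm[measurable]: "X i \<in> borel_measurable M" if "i \<in> I" for i
    using X(1) that by (auto simp: indep_vars_def)
  have Y: "indep_vars (\<lambda>_. borel) Y I"
    unfolding Y_def using indep_vars_compose2[OF X(1), of "\<lambda>_. h"] hm by simp
  have Ym[measurable]: "Y i \<in> borel_measurable M" if "i \<in> I" for i
    using Y that by (auto simp: indep_vars_def)
  have fm[measurable]: "f \<in> borel_measurable (PiM I (\<lambda>_. borel))"
    by (rule lipschitz_in_measurable[OF f(2)]) simp
  have Em: "?E \<in> borel_measurable M"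
    by (rule measurable_compose[OF _ fm]) (use Xm in measurable)
  have Gm: "?G \<in> borel_measurable M"
    by (rule measurable_compose[OF _ fm]) (use Ym in measurable)
  have Rm: "R \<in> borel_measurable M" unfolding R_def L2_set_def by measurable
  have close: "\<bar>?E \<omega> - ?G \<omega>\<bar> \<le> R \<omega>" for \<omega>
  proof -
    have "\<bar>?E \<omega> - ?G \<omega>\<bar> \<le> L2_set (\<lambda>i. (\<lambda>i\<in>I. X i \<omega>) i - (\<lambda>i\<in>I. Y i \<omega>) i) I"
      using f(2)[unfolded lipschitz_in_def mult_1_left, rule_format] .
    also have "\<dots> = R \<omega>" unfolding R_def by (rule L2_set_cong) (auto simp: Y_def h_def)
    finally show ?thesis .
  qed
  define q where "q = exp (- (t\<^sup>2 / (256 * K\<^sup>2)))"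
  have Rq: "prob {\<omega> \<in> space M. t / 4 \<le> R \<omega>} \<le> q"
  proof -
    have "prob {\<omega> \<in> space M. t / 4 \<le> R \<omega>}
        \<le> exp (2 * real (card I) * exp (- (b\<^sup>2 / (2 * (2 * K)\<^sup>2))) - (t / 4)\<^sup>2 / (2 * (2 * K)\<^sup>2))"
      unfolding R_def
      by (rule excess_norm_tail[OF X(1) I(1)]) (use K t b subgaussian_exp_square X(2) in auto)
    also have "\<dots> \<le> q"
    proof -
      have "b\<^sup>2 / (2 * (2 * K)\<^sup>2) = ln (2 + 512 * x)" using K by (simp add: b2 power_mult_distrib)
      hence "exp (- (b\<^sup>2 / (2 * (2 * K)\<^sup>2))) = 1 / (2 + 512 * x)"
        using x by (simp add: exp_minus inverse_eq_divide)
      also have "\<dots> \<le> 1 / (512 * x)" using x by (intro divide_left_mono) auto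
      finally have "2 * n * exp (- (b\<^sup>2 / (2 * (2 * K)\<^sup>2))) \<le> 2 * n * (1 / (512 * x))"
        using n by (intro mult_left_mono) auto
      also have "\<dots> = t\<^sup>2 / (256 * K\<^sup>2)" using n K t by (simp add: x_def field_simps)
      finally have "2 * n * exp (- (b\<^sup>2 / (2 * (2 * K)\<^sup>2))) \<le> t\<^sup>2 / (256 * K\<^sup>2)" .
      moreover have "(t / 4)\<^sup>2 / (2 * (2 * K)\<^sup>2) = 2 * (t\<^sup>2 / (256 * K\<^sup>2))"
        by (simp add: power2_eq_square)
      ultimately show ?thesis unfolding q_def n_def by simp
    qed
    finally show ?thesis .
  qed
  define d where "d = exp (- ((t / 2)\<^sup>2 / (64 * b\<^sup>2)))"
  have Gd: "prob {\<omega> \<in> space M. ?G \<omega> \<le> a} * prob {\<omega> \<in> space M. ?G \<omega> \<ge> a + t / 2} \<le> d" for a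
    unfolding d_def
    by (rule convex_concentration_indep_bounded[OF Y _ b I f]) (use t b in \<open>auto simp: Y_def h_def\<close>)
  have q4: "q \<le> 1/4" and dq: "4 * d + q \<le> 5 * exp (- (w / 20480))" if w: "81920 < w"
  proof -
    have "q \<le> exp (- (w / 512))" using Kw by (simp add: q_def)
    moreover have "exp (- (w / 512)) \<le> exp (- (w / 20480))" using w by simp
    moreover have "d \<le> exp (- (w / 20480))" using bw by (simp add: d_def)
    ultimately show "4 * d + q \<le> 5 * exp (- (w / 20480))" by linarith
    have "1 + w / 512 \<le> exp (w / 512)" by (rule exp_ge_add_one_self)
    hence "4 \<le> exp (w / 512)" using w by linarith
    hence "inverse (exp (w / 512)) \<le> inverse 4" by (intro le_imp_inverse_le) auto
    thus "q \<le> 1/4" using \<open>q \<le> exp (- (w / 512))\<close> by (simp add: exp_minus)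
  qed
  note tails = tails_from_truncation[OF Em Gm Rm close med t Rq q4 Gd]
  note half = median_tails_le_half[OF Em med t]
  show "prob {\<omega> \<in> space M. ?E \<omega> - m \<ge> t} \<le> exp (- rate)" (is "?p \<le> _")
    unfolding rate
  proof (rule absorb_constant[OF half(1)])
    assume w: "81920 < w"
    show "?p \<le> 5 * exp (- (w / 20480))" using tails(1)[OF w] dq[OF w] by (rule order_trans)
  qed
  show "prob {\<omega> \<in> space M. ?E \<omega> - m \<le> - t} \<le> exp (- rate)" (is "?p \<le> _")
    unfolding rate
  proof (rule absorb_constant[OF half(2)])
    assume w: "81920 < w"
    show "?p \<le> 5 * exp (- (w / 20480))" using tails(2)[OF w] dq[OF w] by (rule order_trans)
  qed
qed

end

section \<open>The universal constant and its independence of the space of outcomes\<close>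
lemma convex_fun_restrict:
  assumes "convex_on_Rn n f" shows "convex_fun (\<lambda>x. f (restrict x {..<n}))"
  unfolding convex_fun_def
proof (intro allI impI)
  fix x y :: "nat \<Rightarrow> real" and u v :: real
  assume uv: "0 \<le> u" "0 \<le> v" "u + v = 1"
  have "restrict x {..<n} \<in> Rn n" "restrict y {..<n} \<in> Rn n" by (auto simp: Rn_def)
  with assms uv have "f (\<lambda>i\<in>{..<n}. u * restrict x {..<n} i + v * restrict y {..<n} i)
      \<le> u * f (restrict x {..<n}) + v * f (restrict y {..<n})"
    unfolding convex_on_Rn_def by blast
  also have "(\<lambda>i\<in>{..<n}. u * restrict x {..<n} i + v * restrict y {..<n} i)
      = restrict (\<lambda>i. u * x i + v * y i) {..<n}" by (auto simp: fun_eq_iff)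
  finally show "f (restrict (\<lambda>i. u * x i + v * y i) {..<n})
      \<le> u * f (restrict x {..<n}) + v * f (restrict y {..<n})" .
qed

lemma lipschitz_in_restrict:
  assumes "lipschitz_on_Rn n L f" shows "lipschitz_in {..<n} L (\<lambda>x. f (restrict x {..<n}))"
  unfolding lipschitz_in_def
proof (intro allI)
  fix x y :: "nat \<Rightarrow> real"
  have "restrict x {..<n} \<in> Rn n" "restrict y {..<n} \<in> Rn n" by (auto simp: Rn_def)
  with assms have "\<bar>f (restrict x {..<n}) - f (restrict y {..<n})\<bar>
      \<le> L * L2_set (\<lambda>i. restrict x {..<n} i - restrict y {..<n} i) {..<n}"
    unfolding lipschitz_on_Rn_def by blast
  also have "L2_set (\<lambda>i. restrict x {..<n} i - restrict y {..<n} i) {..<n} = L2_set (\<lambda>i. x i - y i) {..<n}"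
    by (rule L2_set_cong) auto
  finally show "\<bar>f (restrict x {..<n}) - f (restrict y {..<n})\<bar> \<le> L * L2_set (\<lambda>i. x i - y i) {..<n}" .
qed

lemma concentration_const_exists: "concentration_const TYPE('a) (1 / 163840)"
  unfolding concentration_const_def
proof (intro allI impI)
  fix K :: real and n :: nat and M :: "'a measure" and X and f m and t :: real
  assume K: "0 < K" and n: "2 \<le> n" and M: "prob_space M"
    and X: "prob_space.indep_vars M (\<lambda>_. borel) X {..<n}" "\<forall>i<n. subgaussian M K (X i)"
    and f: "convex_on_Rn n f" "lipschitz_on_Rn n 1 f"
    and med: "is_median M (\<lambda>\<omega>. f (random_vector n X \<omega>)) m" and t: "0 < t"
  interpret prob_space M by fact
  have eq: "f (restrict (\<lambda>i\<in>{..<n}. X i \<omega>) {..<n}) = f (random_vector n X \<omega>)" for \<omega>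
    by (simp add: random_vector_def)
  have "0 \<in> {..<n}" using n by simp
  hence "{..<n} \<noteq> {}" by blast
  note * = convex_concentration_subgaussian[OF X(1) _ K finite_lessThan this
      convex_fun_restrict[OF f(1)] lipschitz_in_restrict[OF f(2)] t, unfolded eq, OF _ med]
  show "max (prob {\<omega> \<in> space M. f (random_vector n X \<omega>) - m \<ge> t})
            (prob {\<omega> \<in> space M. f (random_vector n X \<omega>) - m \<le> - t})
          \<le> exp (- (1 / 163840 * t\<^sup>2 / (K\<^sup>2 * ln (2 + K\<^sup>2 * real n / t\<^sup>2))))"
    using * X(2) by (simp add: mult_ac)
qed

text \<open>Independence, subgaussianity, the median and the two tails depend only on the joint law of the
  coordinates, so the coordinate projections under that law, a measure on \<open>nat \<Rightarrow> real\<close>, can replace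
  \<open>X\<close>. Reading off the probabilities under the law uses the measurability of Lipschitz functions.\<close>
lemma concentration_const_transfer:
  assumes C: "concentration_const TYPE(nat \<Rightarrow> real) c"
  shows "concentration_const TYPE('a) c"
  unfolding concentration_const_def
proof (intro allI impI)
  fix K :: real and n :: nat and M :: "'a measure" and X and f m and t :: real
  assume K: "0 < K" and n: "2 \<le> n" and M: "prob_space M"
    and X: "prob_space.indep_vars M (\<lambda>_. borel) X {..<n}" "\<forall>i<n. subgaussian M K (X i)"
    and f: "convex_on_Rn n f" "lipschitz_on_Rn n 1 f"
    and med: "is_median M (\<lambda>\<omega>. f (random_vector n X \<omega>)) m" and t: "0 < t"
  interpret prob_space M by fact
  let ?P = "PiM {..<n} (\<lambda>_. borel) :: (nat \<Rightarrow> real) measure"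
  define N where "N = distr M ?P (random_vector n X)"
  have Xm: "X i \<in> borel_measurable M" if "i < n" for i
    using X(1) that by (auto simp: indep_vars_def)
  have vm[measurable]: "random_vector n X \<in> measurable M ?P"
    unfolding random_vector_def[abs_def] using Xm by (intro measurable_restrict) auto
  have sN[measurable_cong]: "sets N = sets ?P" and spN: "space N = space ?P" by (simp_all add: N_def)
  interpret N: prob_space N unfolding N_def by (rule prob_space_distr) measurable
  have id: "restrict x {..<n} = x" if "x \<in> space N" for x
    using that by (auto simp: spN space_PiM intro: PiE_restrict)
  have id': "random_vector n (\<lambda>i x. x i) x = x" if "x \<in> space N" for x
    using id[OF that] by (simp add: random_vector_def)
  have fm[measurable]: "f \<in> borel_measurable ?P"
  proof -
    have "(\<lambda>x. f (restrict x {..<n})) \<in> borel_measurable ?P"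
      by (rule lipschitz_in_measurable[OF lipschitz_in_restrict[OF f(2)]]) simp
    thus ?thesis using id by (subst (asm) measurable_cong[where g = f]) (auto simp: spN)
  qed
  have meas: "measure N {x \<in> space N. Q (f (random_vector n (\<lambda>i x. x i) x))}
      = prob {\<omega> \<in> space M. Q (f (random_vector n X \<omega>))}" if [measurable]: "Measurable.pred borel Q" for Q
  proof -
    have *: "{x \<in> space N. Q (f (random_vector n (\<lambda>i x. x i) x))} = {x \<in> space ?P. Q (f x)}"
      using id' by (auto simp: spN)
    have "measure N {x \<in> space ?P. Q (f x)} = prob (random_vector n X -` {x \<in> space ?P. Q (f x)} \<inter> space M)"
      unfolding N_def by (rule measure_distr) measurable
    also have "random_vector n X -` {x \<in> space ?P. Q (f x)} \<inter> space M = {\<omega> \<in> space M. Q (f (random_vector n X \<omega>))}"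
      using measurable_space[OF vm] by auto
    finally show ?thesis unfolding * .
  qed
  have cm: "(\<lambda>x. x i) \<in> borel_measurable N" if "i < n" for i
    using that by (subst measurable_cong_sets[OF sN refl]) (auto intro: measurable_component_singleton)
  have marg: "distr N borel (\<lambda>x. x i) = distr M borel (X i)" if "i < n" for i
  proof -
    have "distr N borel (\<lambda>x. x i) = distr M borel ((\<lambda>x. x i) \<circ> random_vector n X)"
      unfolding N_def by (rule distr_distr) (use that in auto)
    also have "(\<lambda>x. x i) \<circ> random_vector n X = X i" using that by (auto simp: random_vector_def)
    finally show ?thesis .
  qed
  have "0 \<in> {..<n}" using n by simp
  hence ne: "{..<n} \<noteq> {}" by blast
  have "N.indep_vars (\<lambda>_. borel) (\<lambda>i x. x i) {..<n}"
  proof (subst N.indep_vars_iff_distr_eq_PiM')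
    have "distr N ?P (\<lambda>x. \<lambda>i\<in>{..<n}. x i) = distr N N (\<lambda>x. x)"
      using id by (intro distr_cong) (auto simp: sN)
    also have "\<dots> = N" by (rule distr_id)
    also have "N = PiM {..<n} (\<lambda>i. distr M borel (X i))"
      using X(1) Xm ne unfolding N_def random_vector_def[abs_def]
      by (subst (asm) indep_vars_iff_distr_eq_PiM') auto
    also have "\<dots> = PiM {..<n} (\<lambda>i. distr N borel (\<lambda>x. x i))"
      by (intro PiM_cong) (auto simp: marg)
    finally show "distr N ?P (\<lambda>x. \<lambda>i\<in>{..<n}. x i) = PiM {..<n} (\<lambda>i. distr N borel (\<lambda>x. x i))" .
  qed (use ne cm in auto)
  moreover have "subgaussian N K (\<lambda>x. x i)" if i: "i < n" for i
  proof -
    have "(\<integral>\<^sup>+x. ennreal (exp ((x i)\<^sup>2 / l\<^sup>2)) \<partial>N) = (\<integral>\<^sup>+\<omega>. ennreal (exp ((X i \<omega>)\<^sup>2 / l\<^sup>2)) \<partial>M)" for l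
      unfolding N_def using i by (subst nn_integral_distr) (auto simp: random_vector_def)
    hence "psi2_norm N (\<lambda>x. x i) = psi2_norm M (X i)" by (simp add: psi2_norm_def)
    thus ?thesis using X(2) i cm[OF i] by (simp add: subgaussian_def)
  qed
  moreover have "is_median N (\<lambda>x. f (random_vector n (\<lambda>i x. x i) x)) m"
    using med meas[of "\<lambda>z. z \<ge> m"] meas[of "\<lambda>z. z \<le> m"] by (simp add: is_median_def)
  ultimately have "max (measure N {x \<in> space N. f (random_vector n (\<lambda>i x. x i) x) - m \<ge> t})
            (measure N {x \<in> space N. f (random_vector n (\<lambda>i x. x i) x) - m \<le> - t})
          \<le> exp (- (c * t\<^sup>2 / (K\<^sup>2 * ln (2 + K\<^sup>2 * real n / t\<^sup>2))))"
    using C[unfolded concentration_const_def, rule_format, OF K n N.prob_space_axioms _ _ f _ t] by blast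
  thus "max (prob {\<omega> \<in> space M. f (random_vector n X \<omega>) - m \<ge> t})
            (prob {\<omega> \<in> space M. f (random_vector n X \<omega>) - m \<le> - t})
          \<le> exp (- (c * t\<^sup>2 / (K\<^sup>2 * ln (2 + K\<^sup>2 * real n / t\<^sup>2))))"
    using meas[of "\<lambda>z. z - m \<ge> t"] meas[of "\<lambda>z. z - m \<le> - t"] by simp
qed

theorem theorem1p3:
  "(\<exists>c>0. concentration_const TYPE(nat \<Rightarrow> real) c) \<and>
   (\<forall>c. concentration_const TYPE(nat \<Rightarrow> real) c \<longrightarrow> concentration_const TYPE('a) c)"
proof (intro conjI allI impI)
  have "(0::real) < 1 / 163840" by simp
  thus "\<exists>c>0. concentration_const TYPE(nat \<Rightarrow> real) c"
    using concentration_const_exists by blast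
qed (rule concentration_const_transfer)

end
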